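(* Let $X$ be a sequentially complete locally convex space, $T$ an nn-bounded linear operator on $X$, and $\lambda\in\mathbb{C}$. If $|\lambda|>r_{nn}(T)$, then $\lambda I-T$ is invertible, the Neumann series $\sum_{i=0}^\infty \frac{T^i}{\lambda^{i+1}}$ nn-converges to $R_\lambda=(\lambda I-T)^{-1}$, and $R_\lambda$ is nn-bounded. In particular, $|\sigma^{nn}(T)|\le r_{nn}(T)$.
   Context: Spaces are over $\mathbb{C}$; locally convex spaces are Hausdorff by definition. Every base $\mathcal{N}_0$ of zero neighborhoods that is mentioned is assumed to consist of balanced sets and to satisfy: for $V_1,V_2\in\mathcal{N}_0$ there is $V\in\mathcal{N}_0$ with $V\subseteq V_1\cap V_2$; for $V\in\mathcal{N}_0$ there is $U\in\mathcal{N}_0$ with $U+U\subseteq V$; and $\lambda V\in\mathcal{N}_0$ for $V\in\mathcal{N}_0$ and every nonzero scalar $\lambda$. In a locally convex space the members of such a base are moreover assumed convex. A linear operator $T$ on $X$ is nn-bounded if there is a base $\mathcal{N}_0$ of zero neighborhoods such that for every $U\in\mathcal{N}_0$ there is $\alpha>0$ with $T(U)\subseteq\alpha U$. A sequence $(S_n)$ of operators nn-converges to zero if there is a base $\mathcal{N}_0$ of zero neighborhoods such that for every $U\in\mathcal{N}_0$ and every $\varepsilon>0$ we have $S_n(U)\subseteq\varepsilon U$ for all sufficiently large $n$; $(S_n)$ nn-converges to $S$ if $(S_n-S)$ nn-converges to zero; convergence of a series means convergence of its partial sums. $\rho^{nn}(T)$ is the set of $\lambda\in\mathbb{C}$ for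 which $\lambda I-T$ has a (two-sided) inverse which is nn-bounded; $\sigma^{nn}(T)=\mathbb{C}\setminus\rho^{nn}(T)$. For $\sigma\subseteq\mathbb{C}$, $|\sigma|=\sup\{|\lambda| : \lambda\in\sigma\}$, with $\sup\emptyset=0$. The spectral radius is $$r_{nn}(T)=\inf\Bigl\{\nu>0 : \bigl(\tfrac{T^n}{\nu^n}\bigr) \text{ nn-converges to zero}\Bigr\},$$ with $\inf\emptyset=\infty$. *)

theory Defs
  imports "HOL-Analysis.Analysis"
begin

text \<open>
  The distribution has no class of complex vector spaces. The complex structure is added on top of
  \<^class>\<open>real_vector\<close> (the underlying real structure being the restriction of the complex one),
  so that the library notion of convexity is available.
\<close>

class complex_tvs = real_vector + topological_ab_group_add + t2_space +
  fixes scaleC :: "complex \<Rightarrow> 'a \<Rightarrow> 'a"  (infixr \<open>*\<^sub>C\<close> 75)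
  assumes scaleC_add_right: "c *\<^sub>C (x + y) = c *\<^sub>C x + c *\<^sub>C y"
    and scaleC_add_left: "(c + d) *\<^sub>C x = c *\<^sub>C x + d *\<^sub>C x"
    and scaleC_scaleC: "c *\<^sub>C d *\<^sub>C x = (c * d) *\<^sub>C x"
    and scaleR_scaleC: "r *\<^sub>R x = complex_of_real r *\<^sub>C x"
    and tendsto_scaleC_Pair:
      "LIM p (nhds c \<times>\<^sub>F nhds x). fst p *\<^sub>C snd p :> nhds (c *\<^sub>C x)"

text \<open>
  The library predicate \<^const>\<open>convex\<close> cannot occur in a class specification; its definition is
  written out and folded back in the lemma that follows.
\<close>

class complex_lcs = complex_tvs +
  assumes locally_convex_raw:
    "open U \<Longrightarrow> 0 \<in> U \<Longrightarrow> \<exists>V W. open W \<and> 0 \<in> W \<and> W \<subseteq> V \<and> V \<subseteq> U \<and>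
       (\<forall>x\<in>V. \<forall>y\<in>V. \<forall>u\<ge>0. \<forall>v\<ge>0. u + v = 1 \<longrightarrow> u *\<^sub>R x + v *\<^sub>R y \<in> V)"

lemma locally_convex:
  fixes U :: "'a::complex_lcs set"
  assumes "open U" "0 \<in> U"
  shows "\<exists>V W. open W \<and> 0 \<in> W \<and> W \<subseteq> V \<and> V \<subseteq> U \<and> convex V"
  using locally_convex_raw[OF assms] unfolding convex_def .

text \<open>Cauchy sequences with respect to the uniformity induced by the additive group.\<close>

definition (in complex_tvs) tvs_Cauchy :: "(nat \<Rightarrow> 'a) \<Rightarrow> bool" where
  "tvs_Cauchy X \<longleftrightarrow>
     (\<forall>U. open U \<and> 0 \<in> U \<longrightarrow> (\<exists>N. \<forall>m\<ge>N. \<forall>n\<ge>N. X m - X n \<in> U))"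

class seq_complete_lcs = complex_lcs +
  assumes tvs_Cauchy_convergent: "tvs_Cauchy X \<Longrightarrow> convergent X"

definition balanced :: "'a::complex_tvs set \<Rightarrow> bool" where
  "balanced U \<longleftrightarrow> (\<forall>c. cmod c \<le> 1 \<longrightarrow> scaleC c ` U \<subseteq> U)"

text \<open>Members of a base are neighborhoods of zero, not necessarily open.\<close>

definition zero_base :: "'a::complex_lcs set set \<Rightarrow> bool" where
  "zero_base \<N> \<longleftrightarrow>
     (\<forall>V\<in>\<N>. 0 \<in> interior V) \<and>
     (\<forall>W. 0 \<in> interior W \<longrightarrow> (\<exists>V\<in>\<N>. V \<subseteq> W)) \<and>
     (\<forall>V\<in>\<N>. balanced V \<and> convex V) \<and>
     (\<forall>V\<^sub>1\<in>\<N>. \<forall>V\<^sub>2\<in>\<N>. \<exists>V\<in>\<N>. V \<subseteq> V\<^sub>1 \<inter> V\<^sub>2) \<and>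
     (\<forall>V\<in>\<N>. \<exists>U\<in>\<N>. {x + y |x y. x \<in> U \<and> y \<in> U} \<subseteq> V) \<and>
     (\<forall>V\<in>\<N>. \<forall>c. c \<noteq> 0 \<longrightarrow> scaleC c ` V \<in> \<N>)"

definition clinear :: "('a::complex_tvs \<Rightarrow> 'a) \<Rightarrow> bool" where
  "clinear T \<longleftrightarrow> Vector_Spaces.linear scaleC scaleC T"

definition nn_bounded :: "('a::complex_lcs \<Rightarrow> 'a) \<Rightarrow> bool" where
  "nn_bounded T \<longleftrightarrow> clinear T \<and>
     (\<exists>\<N>. zero_base \<N> \<and> (\<forall>U\<in>\<N>. \<exists>\<alpha>>0. T ` U \<subseteq> scaleR \<alpha> ` U))"

definition nn_converges_zero :: "(nat \<Rightarrow> 'a::complex_lcs \<Rightarrow> 'a) \<Rightarrow> bool" where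
  "nn_converges_zero S \<longleftrightarrow>
     (\<exists>\<N>. zero_base \<N> \<and>
       (\<forall>U\<in>\<N>. \<forall>\<epsilon>>0. \<forall>\<^sub>F n in sequentially. S n ` U \<subseteq> scaleR \<epsilon> ` U))"

definition nn_converges :: "(nat \<Rightarrow> 'a::complex_lcs \<Rightarrow> 'a) \<Rightarrow> ('a \<Rightarrow> 'a) \<Rightarrow> bool" where
  "nn_converges S L \<longleftrightarrow> nn_converges_zero (\<lambda>n x. S n x - L x)"

definition nn_sums :: "(nat \<Rightarrow> 'a::complex_lcs \<Rightarrow> 'a) \<Rightarrow> ('a \<Rightarrow> 'a) \<Rightarrow> bool" where
  "nn_sums A L \<longleftrightarrow> nn_converges (\<lambda>n x. \<Sum>i<n. A i x) L"

definition shifted :: "complex \<Rightarrow> ('a::complex_tvs \<Rightarrow> 'a) \<Rightarrow> 'a \<Rightarrow> 'a" where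
  "shifted z T = (\<lambda>x. z *\<^sub>C x - T x)"

definition nn_resolvent_set :: "('a::complex_lcs \<Rightarrow> 'a) \<Rightarrow> complex set" where
  "nn_resolvent_set T = {z. bij (shifted z T) \<and> nn_bounded (inv (shifted z T))}"

definition nn_spectrum :: "('a::complex_lcs \<Rightarrow> 'a) \<Rightarrow> complex set" where
  "nn_spectrum T = - nn_resolvent_set T"

text \<open>In \<^typ>\<open>ennreal\<close> the supremum of the empty set is 0 and the infimum is \<open>\<infinity>\<close>.\<close>

definition set_modulus :: "complex set \<Rightarrow> ennreal" where
  "set_modulus \<sigma> = (SUP z\<in>\<sigma>. ennreal (cmod z))"

definition nn_spectral_radius :: "('a::complex_lcs \<Rightarrow> 'a) \<Rightarrow> ennreal" where
  "nn_spectral_radius T =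
     (INF \<nu>\<in>{\<nu>. \<nu> > 0 \<and> nn_converges_zero (\<lambda>n x. (1 / \<nu> ^ n) *\<^sub>R (T ^^ n) x)}. ennreal \<nu>)"

end

theory Submission
  imports Defs
begin

text \<open>
  The bases witnessing that \<open>T\<close> is nn-bounded and that \<open>T\<^sup>n / \<nu>\<^sup>n\<close> nn-converges to zero need not
  agree, so the first finitely many powers of \<open>T\<close> are not controlled on the second base. This is
  repaired by replacing a member \<open>U\<close> of the second base by the set of all \<open>x\<close> with
  \<open>T\<^sup>i x / \<nu>\<^sup>i \<in> U\<close> for every \<open>i\<close>. On \<open>U\<close> all but finitely many of these conditions are automatic, so by
  continuity of \<open>T\<close> this set is a zero neighborhood, and \<open>T\<close> maps it into \<open>\<nu>\<close> times itself. Hence the balanced convex zero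
  neighborhoods \<open>V\<close> with \<open>T V \<subseteq> \<nu> V\<close> form a base, and on it the Neumann series is dominated by a
  geometric series with ratio \<open>\<nu> / |\<lambda>|\<close>.
\<close>

section \<open>Complex scaling and dilations of zero neighborhoods\<close>

interpretation scaleC: vector_space "scaleC :: complex \<Rightarrow> 'a \<Rightarrow> 'a::complex_tvs"
proof
  \<comment> \<open>The class does not assume the unit law; it is the compatibility with real
    scaling at the scalar 1.\<close>
  show "1 *\<^sub>C x = x" for x :: 'a
    using scaleR_scaleC[of 1 x] by simp
qed (simp_all add: scaleC_add_right scaleC_add_left scaleC_scaleC)

lemma tendsto_scaleC:
  fixes g :: "'b \<Rightarrow> 'a::complex_tvs"
  assumes "(f \<longlongrightarrow> a) F" "(g \<longlongrightarrow> b) F"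
  shows "((\<lambda>x. f x *\<^sub>C g x) \<longlongrightarrow> a *\<^sub>C b) F"
  using filterlim_compose[OF tendsto_scaleC_Pair filterlim_Pair[OF assms]] by simp

lemma scaleC_image_eq_vimage:
  fixes V :: "'a::complex_tvs set"
  assumes "c \<noteq> 0"
  shows "scaleC c ` V = scaleC (inverse c) -` V"
proof (intro equalityI subsetI)
  fix x assume "x \<in> scaleC (inverse c) -` V"
  moreover have "x = c *\<^sub>C inverse c *\<^sub>C x"
    using assms by simp
  ultimately show "x \<in> scaleC c ` V" by blast
qed (use assms in auto)

lemma scaleR_image_iff:
  fixes V :: "'a::real_vector set"
  assumes "a \<noteq> 0"
  shows "x \<in> scaleR a ` V \<longleftrightarrow> inverse a *\<^sub>R x \<in> V"
proof
  assume "inverse a *\<^sub>R x \<in> V"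
  moreover have "x = a *\<^sub>R inverse a *\<^sub>R x"
    using assms by simp
  ultimately show "x \<in> scaleR a ` V" by blast
qed (use assms in auto)

lemma zero_in_interior_scaleC:
  fixes V :: "'a::complex_tvs set"
  assumes "0 \<in> interior V" "c \<noteq> 0"
  shows "0 \<in> interior (scaleC c ` V)"
proof -
  have "continuous_on UNIV (scaleC (inverse c) :: 'a \<Rightarrow> 'a)"
    unfolding continuous_on_def by (intro ballI tendsto_scaleC tendsto_const tendsto_ident_at)
  then have "open (scaleC (inverse c) -` interior V)"
    by (simp add: open_vimage)
  moreover have "scaleC (inverse c) -` interior V \<subseteq> scaleC c ` V"
    unfolding scaleC_image_eq_vimage[OF assms(2)] using interior_subset by blast
  ultimately show ?thesis
    using assms(1) by (intro interiorI[of "scaleC (inverse c) -` interior V"]) auto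
qed

lemma zero_in_interior_scaleR:
  fixes V :: "'a::complex_tvs set"
  assumes "0 \<in> interior V" "a \<noteq> 0"
  shows "0 \<in> interior (scaleR a ` V)"
  using zero_in_interior_scaleC[OF assms(1), of "complex_of_real a"] assms(2)
  by (simp add: scaleR_scaleC[abs_def])

text \<open>Continuity of the scalar multiplication sends \<open>x / (n + 1)\<close> to 0, so some
  term lies in \<open>V\<close>; \<open>t\<close> is that \<open>n + 1\<close>.\<close>

lemma absorbing:
  fixes V :: "'a::complex_tvs set"
  assumes "0 \<in> interior V"
  obtains t :: real where "t > 0" "x \<in> scaleR t ` V"
proof -
  have "(\<lambda>n. complex_of_real (inverse (real (Suc n)))) \<longlonglongrightarrow> of_real 0"
    by (intro tendsto_of_real LIMSEQ_inverse_real_of_nat)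
  then have "(\<lambda>n. complex_of_real (inverse (real (Suc n))) *\<^sub>C x) \<longlonglongrightarrow> of_real 0 *\<^sub>C x"
    by (intro tendsto_scaleC tendsto_const)
  then have "(\<lambda>n. inverse (real (Suc n)) *\<^sub>R x) \<longlonglongrightarrow> 0"
    by (simp add: scaleR_scaleC)
  then have "\<forall>\<^sub>F n in sequentially. inverse (real (Suc n)) *\<^sub>R x \<in> interior V"
    using assms by (auto dest: topological_tendstoD[OF _ open_interior])
  then obtain n where "inverse (real (Suc n)) *\<^sub>R x \<in> interior V"
    using eventually_happens'[OF sequentially_bot] by blast
  then have "inverse (real (Suc n)) *\<^sub>R x \<in> V"
    using interior_subset by blast
  then show ?thesis
    using that[of "real (Suc n)"] scaleR_image_iff[of "real (Suc n)" x V] by simp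
qed

section \<open>Arithmetic of dilates of balanced and convex sets\<close>

text \<open>Writing \<open>x\<close> as \<open>a\<close> times \<open>v\<close>, the scalar
  \<open>c * a / b\<close> has modulus at most 1, so it keeps \<open>v\<close> in \<open>V\<close>.
  If \<open>b = 0\<close>, the bound forces the scaled vector to be 0.\<close>

lemma balanced_scaleC:
  fixes V :: "'a::complex_tvs set"
  assumes "balanced V" "x \<in> scaleR a ` V" "cmod c * \<bar>a\<bar> \<le> b"
  shows "c *\<^sub>C x \<in> scaleR b ` V"
proof -
  obtain v where v: "v \<in> V" "x = a *\<^sub>R v"
    using assms(2) by blast
  show ?thesis
  proof (cases "b = 0")
    case True
    then have "cmod c * \<bar>a\<bar> = 0"
      using assms(3) by (metis abs_ge_zero antisym mult_nonneg_nonneg norm_ge_zero)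
    then have "c *\<^sub>C x = 0"
      using v by auto
    then show ?thesis
      using True v by force
  next
    case False
    then have "b > 0"
      using assms(3) by (smt (verit) mult_nonneg_nonneg norm_ge_zero)
    then have "cmod (c * of_real a / of_real b) \<le> 1"
      using assms(3) by (simp add: norm_mult norm_divide)
    then have "(c * of_real a / of_real b) *\<^sub>C v \<in> V"
      using assms(1) v unfolding balanced_def by blast
    moreover have "c *\<^sub>C x = b *\<^sub>R ((c * of_real a / of_real b) *\<^sub>C v)"
      using v \<open>b > 0\<close> by (simp add: scaleR_scaleC)
    ultimately show ?thesis by blast
  qed
qed

lemma balanced_scaleR_mono:
  fixes V :: "'a::complex_tvs set"
  assumes "balanced V" "x \<in> scaleR a ` V" "\<bar>a\<bar> \<le> b"
  shows "x \<in> scaleR b ` V"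
  using balanced_scaleC[OF assms(1,2), of 1 b] assms(3) by simp

lemma balanced_uminus:
  fixes V :: "'a::complex_tvs set"
  assumes "balanced V" "x \<in> scaleR a ` V" "a \<ge> 0"
  shows "- x \<in> scaleR a ` V"
  using balanced_scaleC[OF assms(1,2), of "-1" a] assms(3) by simp

text \<open>After division by \<open>a + b\<close> the sum is a convex combination with weights
  \<open>a / (a + b)\<close> and \<open>b / (a + b)\<close>.\<close>

lemma convex_scaleR_add:
  fixes V :: "'a::real_vector set"
  assumes "convex V" "x \<in> scaleR a ` V" "y \<in> scaleR b ` V" "a \<ge> 0" "b \<ge> 0"
  shows "x + y \<in> scaleR (a + b) ` V"
proof -
  obtain v w where v: "v \<in> V" "x = a *\<^sub>R v" "w \<in> V" "y = b *\<^sub>R w"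
    using assms by blast
  show ?thesis
  proof (cases "a + b = 0")
    case True
    then have "a = 0" "b = 0" using assms by auto
    then show ?thesis using v by force
  next
    case False
    then have "(a / (a + b)) *\<^sub>R v + (b / (a + b)) *\<^sub>R w \<in> V"
      using assms v by (intro convexD) (auto simp: add_divide_distrib[symmetric])
    moreover have "x + y = (a + b) *\<^sub>R ((a / (a + b)) *\<^sub>R v + (b / (a + b)) *\<^sub>R w)"
      using False v by (simp add: scaleR_add_right)
    ultimately show ?thesis by blast
  qed
qed

lemma convex_scaleR_sum:
  fixes V :: "'a::real_vector set"
  assumes "finite I" "convex V" "0 \<in> V"
    and "\<And>i. i \<in> I \<Longrightarrow> f i \<in> scaleR (a i) ` V" "\<And>i. i \<in> I \<Longrightarrow> a i \<ge> 0"
  shows "(\<Sum>i\<in>I. f i) \<in> scaleR (\<Sum>i\<in>I. a i) ` V"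
  using assms(1,4,5)
proof (induction I rule: finite_induct)
  case empty
  then show ?case using assms(3) by force
next
  case (insert i I)
  then show ?case
    by (auto intro!: convex_scaleR_add[OF assms(2)] sum_nonneg)
qed

text \<open>\<open>V\<close> may fail to be closed, so passing to the limit costs a factor 2: for
  large \<open>n\<close> both \<open>X n\<close> and the error \<open>l - X n\<close> lie in the
  dilate by \<open>a\<close>, and convexity adds them.\<close>

lemma limit_in_double:
  fixes V :: "'a::complex_tvs set"
  assumes "0 \<in> interior V" "balanced V" "convex V" "a > 0"
    and "X \<longlonglongrightarrow> l" "\<forall>\<^sub>F n in sequentially. X n \<in> scaleR a ` V"
  shows "l \<in> scaleR (2 * a) ` V"
proof -
  have "(\<lambda>n. l - X n) \<longlonglongrightarrow> l - l"
    by (intro tendsto_diff tendsto_const assms(5))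
  moreover have "0 \<in> interior (scaleR a ` V)"
    using zero_in_interior_scaleR assms(1,4) by (metis less_irrefl)
  ultimately have "\<forall>\<^sub>F n in sequentially. l - X n \<in> interior (scaleR a ` V)"
    using topological_tendstoD[OF _ open_interior] by simp
  with assms(6) have "\<forall>\<^sub>F n in sequentially. l \<in> scaleR (2 * a) ` V"
  proof eventually_elim
    case (elim n)
    then have "X n + (l - X n) \<in> scaleR (a + a) ` V"
      using assms(3,4) interior_subset by (intro convex_scaleR_add) (auto 4 3)
    then show ?case by simp
  qed
  then show ?thesis by simp
qed

section \<open>Complex-linear maps\<close>

lemma clinear_iff:
  "clinear T \<longleftrightarrow> (\<forall>x y. T (x + y) = T x + T y) \<and> (\<forall>c x. T (c *\<^sub>C x) = c *\<^sub>C T x)"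
proof
  assume "clinear T"
  then interpret Vector_Spaces.linear scaleC scaleC T
    unfolding clinear_def .
  show "(\<forall>x y. T (x + y) = T x + T y) \<and> (\<forall>c x. T (c *\<^sub>C x) = c *\<^sub>C T x)"
    by (simp add: add scale)
qed (unfold clinear_def, unfold_locales, auto)

lemma clinear_scaleR: "clinear T \<Longrightarrow> T (a *\<^sub>R x) = a *\<^sub>R T x"
  by (simp add: clinear_iff scaleR_scaleC)

lemma clinear_zero: "clinear T \<Longrightarrow> T 0 = 0"
  using clinear_scaleR[of T 0 0] by simp

lemma clinear_diff:
  assumes "clinear T"
  shows "T (x - y) = T x - T y"
proof -
  have "T (x - y) + T y = T (x - y + y)"
    using assms unfolding clinear_iff by metis
  then show ?thesis by (simp add: eq_diff_eq)
qed

lemma clinear_sum: "clinear T \<Longrightarrow> T (\<Sum>i\<in>I. f i) = (\<Sum>i\<in>I. T (f i))"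
  by (induction I rule: infinite_finite_induct) (auto simp: clinear_zero clinear_iff)

lemma clinear_funpow: "clinear T \<Longrightarrow> clinear (T ^^ n)"
  by (induction n) (auto simp: clinear_iff)

lemma clinear_compose_scaleR: "clinear T \<Longrightarrow> clinear (\<lambda>x. a *\<^sub>R T x)"
  by (simp add: clinear_iff scaleR_scaleC scaleC_add_right mult.commute)

lemma clinear_inv:
  assumes "clinear T" "bij T"
  shows "clinear (inv T)"
proof -
  have T_inv: "T (inv T x) = x" for x
    using assms(2) by (simp add: bij_is_surj surj_f_inv_f)
  have inv_eq: "inv T x = y" if "T y = x" for x y
    using assms(2) that by (auto simp: bij_is_inj)
  have "inv T (x + y) = inv T x + inv T y" "inv T (c *\<^sub>C x) = c *\<^sub>C inv T x" for x y c
    by (rule inv_eq, use assms(1) in \<open>simp add: clinear_iff T_inv\<close>)+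
  then show ?thesis by (simp add: clinear_iff)
qed

lemma clinear_shifted: "clinear T \<Longrightarrow> clinear (shifted z T)"
  by (simp add: clinear_iff shifted_def scaleC_add_right scaleC.scale_right_diff_distrib mult.commute)

lemma balanced_vimage: "clinear T \<Longrightarrow> balanced V \<Longrightarrow> balanced (T -` V)"
  by (auto simp: balanced_def clinear_iff image_subset_iff)

lemma convex_clinear_vimage: "clinear T \<Longrightarrow> convex V \<Longrightarrow> convex (T -` V)"
  by (intro convexI) (simp add: convexD clinear_scaleR clinear_iff[THEN iffD1, THEN conjunct1])

section \<open>Zero bases and continuity of nn-bounded operators\<close>

lemma zero_base_memD:
  assumes "zero_base \<N>" "V \<in> \<N>"
  shows "0 \<in> interior V" "balanced V" "convex V"
  using assms by (simp_all add: zero_base_def)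

lemma zero_base_obtain:
  assumes "zero_base \<N>" "0 \<in> interior W"
  obtains V where "V \<in> \<N>" "V \<subseteq> W"
  using assms by (auto simp: zero_base_def)

text \<open>This is continuity at 0: if \<open>T\<close> maps \<open>U\<close> into
  \<open>\<alpha>\<close> times \<open>U\<close>, it maps the dilate of \<open>U\<close> by
  \<open>inverse \<alpha>\<close> into \<open>U\<close>, hence into \<open>W\<close>.\<close>

lemma nn_bounded_vimage:
  assumes "nn_bounded T" "0 \<in> interior W"
  shows "0 \<in> interior (T -` W)"
proof -
  obtain \<N> where \<N>: "zero_base \<N>" "\<forall>U\<in>\<N>. \<exists>\<alpha>>0. T ` U \<subseteq> scaleR \<alpha> ` U"
    using assms(1) unfolding nn_bounded_def by blast
  have T: "clinear T" using assms(1) nn_bounded_def by blast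
  obtain U where U: "U \<in> \<N>" "U \<subseteq> W"
    using zero_base_obtain[OF \<N>(1) assms(2)] .
  obtain \<alpha> where \<alpha>: "\<alpha> > 0" "T ` U \<subseteq> scaleR \<alpha> ` U"
    using \<N>(2) U by blast
  have "0 \<in> interior U"
    using zero_base_memD(1)[OF \<N>(1) U(1)] .
  then have "0 \<in> interior (scaleR (inverse \<alpha>) ` U)"
    using \<alpha> by (intro zero_in_interior_scaleR) auto
  moreover have "scaleR (inverse \<alpha>) ` U \<subseteq> T -` W"
  proof clarify
    fix u assume "u \<in> U"
    then obtain w where "w \<in> U" "T u = \<alpha> *\<^sub>R w"
      using \<alpha> by blast
    then show "inverse \<alpha> *\<^sub>R u \<in> T -` W"
      using U(2) \<alpha>(1) by (auto simp: clinear_scaleR[OF T])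
  qed
  ultimately show ?thesis
    using interior_mono by blast
qed

text \<open>Linearity carries continuity at 0 to every point, via the differences
  \<open>X n - l\<close>.\<close>

lemma tendsto_nn_bounded:
  assumes "nn_bounded T" "(X \<longlongrightarrow> l) F"
  shows "((\<lambda>n. T (X n)) \<longlongrightarrow> T l) F"
proof -
  have T: "clinear T" using assms(1) nn_bounded_def by blast
  have "((\<lambda>n. T (X n - l)) \<longlongrightarrow> 0) F"
  proof (rule topological_tendstoI)
    fix S :: "'a set" assume "open S" "0 \<in> S"
    then have "0 \<in> interior (T -` S)"
      by (intro nn_bounded_vimage[OF assms(1)]) (simp add: interior_open)
    moreover have "((\<lambda>n. X n - l) \<longlongrightarrow> 0) F"
      using tendsto_diff[OF assms(2) tendsto_const[of l]] by simp
    ultimately have "\<forall>\<^sub>F n in F. X n - l \<in> interior (T -` S)"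
      using topological_tendstoD[OF _ open_interior] by blast
    then show "\<forall>\<^sub>F n in F. T (X n - l) \<in> S"
      by eventually_elim (use interior_subset in blast)
  qed
  then have "((\<lambda>n. T (X n - l) + T l) \<longlongrightarrow> 0 + T l) F"
    by (intro tendsto_add tendsto_const)
  then show ?thesis
    by (simp add: clinear_diff[OF T])
qed

section \<open>The base of neighborhoods adapted to \<open>T\<close> and
  \<open>\<nu>\<close>\<close>

definition contracted_nbhds :: "('a::complex_lcs \<Rightarrow> 'a) \<Rightarrow> real \<Rightarrow> 'a set set" where
  "contracted_nbhds T \<nu> =
     {V. 0 \<in> interior V \<and> balanced V \<and> convex V \<and> T ` V \<subseteq> scaleR \<nu> ` V}"

lemma contracted_nbhd_exists:
  fixes T :: "'a::complex_lcs \<Rightarrow> 'a"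
  assumes bdd: "nn_bounded T" and \<nu>: "\<nu> > 0"
    and conv: "nn_converges_zero (\<lambda>n x. (1 / \<nu> ^ n) *\<^sub>R (T ^^ n) x)"
    and W: "0 \<in> interior W"
  shows "\<exists>V\<in>contracted_nbhds T \<nu>. V \<subseteq> W"
proof -
  define S where "S i x = (1 / \<nu> ^ i) *\<^sub>R (T ^^ i) x" for i x
  have T: "clinear T" using bdd nn_bounded_def by blast
  have S: "clinear (S i)" for i
    unfolding S_def by (intro clinear_compose_scaleR clinear_funpow T)
  obtain \<N> where \<N>: "zero_base \<N>"
    and conv': "\<forall>U\<in>\<N>. \<forall>\<epsilon>>0. \<forall>\<^sub>F n in sequentially. S n ` U \<subseteq> scaleR \<epsilon> ` U"
    using conv unfolding nn_converges_zero_def S_def by blast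
  obtain U where U: "U \<in> \<N>" "U \<subseteq> W"
    using zero_base_obtain[OF \<N> W] .
  have U': "0 \<in> interior U" "balanced U" "convex U"
    using zero_base_memD[OF \<N> U(1)] .
  \<comment> \<open>With \<open>\<epsilon> = 1\<close>, nn-convergence gives an \<open>N\<close>
    from which on the scaled powers map \<open>U\<close> into itself.\<close>
  obtain N where N: "\<And>n. n \<ge> N \<Longrightarrow> S n ` U \<subseteq> U"
    using conv'[rule_format, OF U(1), of 1] by (auto simp: eventually_sequentially)
  have pow: "0 \<in> interior ((T ^^ i) -` Y)" if "0 \<in> interior Y" for i Y
    using that
  proof (induction i arbitrary: Y)
    case (Suc i)
    then show ?case
      using Suc.IH[OF nn_bounded_vimage[OF bdd Suc.prems]] by (simp add: vimage_def o_def)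
  qed simp
  have nbhd: "0 \<in> interior (S i -` U)" for i
  proof -
    \<comment> \<open>Moving the factor \<open>\<nu> ^ i\<close> to the other side leaves a preimage
      under a pure power of \<open>T\<close>, to which \<open>pow\<close> applies.\<close>
    have "S i -` U = (T ^^ i) -` (scaleR (\<nu> ^ i) ` U)"
      using \<nu> by (auto simp: S_def scaleR_image_iff inverse_eq_divide)
    then show ?thesis
      using \<nu> U'(1) by (auto intro!: pow zero_in_interior_scaleR)
  qed
  define V where "V = (\<Inter>i. S i -` U)"
  have "0 \<in> interior (U \<inter> (\<Inter>i<N. S i -` U))"
  proof -
    have "0 \<in> interior (\<Inter>i<M. S i -` U)" for M
      by (induction M) (auto simp: lessThan_Suc nbhd)
    then show ?thesis using U' by simp
  qed
  \<comment> \<open>The infinite intersection \<open>V\<close> contains a finite one: on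
    \<open>U\<close> the conditions with \<open>i \<ge> N\<close> hold by the choice of
    \<open>N\<close>.\<close>
  moreover have "U \<inter> (\<Inter>i<N. S i -` U) \<subseteq> V"
  proof
    fix x assume x: "x \<in> U \<inter> (\<Inter>i<N. S i -` U)"
    have "S i x \<in> U" for i
      using x N[of i] by (cases "i < N") auto
    then show "x \<in> V" by (simp add: V_def)
  qed
  ultimately have "0 \<in> interior V"
    using interior_mono by blast
  moreover have "balanced V"
    using balanced_vimage[OF S U'(2)] by (simp add: V_def balanced_def image_subset_iff)
  moreover have "convex V"
    unfolding V_def by (intro convex_INT convex_clinear_vimage S U'(3))
  moreover have "T ` V \<subseteq> scaleR \<nu> ` V"
  proof clarify
    fix x assume x: "x \<in> V"
    \<comment> \<open>Applying \<open>T / \<nu>\<close> only shifts the index, so the conditions on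
      the image are among those that \<open>x\<close> satisfies.\<close>
    have "S i (inverse \<nu> *\<^sub>R T x) = S (Suc i) x" for i
      using \<nu> by (simp add: S_def clinear_scaleR[OF clinear_funpow[OF T]] funpow_swap1 divide_simps)
    then have "inverse \<nu> *\<^sub>R T x \<in> V"
      using x by (simp add: V_def)
    then show "T x \<in> scaleR \<nu> ` V"
      using \<nu> by (simp add: scaleR_image_iff)
  qed
  moreover have "V \<subseteq> W"
    \<comment> \<open>The condition with index 0 reads \<open>x \<in> U\<close>.\<close>
    using U(2) unfolding V_def by (auto simp: S_def dest!: spec[of _ 0])
  ultimately show ?thesis
    unfolding contracted_nbhds_def by blast
qed

lemma contracted_nbhds_scaleC:
  assumes "clinear T" "V \<in> contracted_nbhds T \<nu>" "c \<noteq> 0"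
  shows "scaleC c ` V \<in> contracted_nbhds T \<nu>"
proof -
  have V: "0 \<in> interior V" "balanced V" "convex V" "T ` V \<subseteq> scaleR \<nu> ` V"
    using assms(2) by (auto simp: contracted_nbhds_def)
  \<comment> \<open>The dilate of \<open>V\<close> by \<open>c\<close> is the preimage of
    \<open>V\<close> under scaling by \<open>inverse c\<close>, so it inherits balancedness and
    convexity through the preimage lemmas.\<close>
  have lin: "clinear (scaleC (inverse c) :: 'a \<Rightarrow> 'a)"
    by (simp add: clinear_iff scaleC_add_right mult.commute)
  have "T ` scaleC c ` V \<subseteq> scaleR \<nu> ` scaleC c ` V"
  proof clarify
    fix v assume "v \<in> V"
    then obtain w where w: "w \<in> V" "T v = \<nu> *\<^sub>R w"
      using V(4) by blast
    then have "T (c *\<^sub>C v) = \<nu> *\<^sub>R c *\<^sub>C w"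
      using assms(1) by (simp add: clinear_iff scaleR_scaleC mult.commute)
    then show "T (c *\<^sub>C v) \<in> scaleR \<nu> ` scaleC c ` V"
      using w(1) by blast
  qed
  then show ?thesis
    using zero_in_interior_scaleC[OF V(1) assms(3)]
      balanced_vimage[OF lin V(2)] convex_clinear_vimage[OF lin V(3)]
    by (simp add: contracted_nbhds_def scaleC_image_eq_vimage[OF assms(3), of V])
qed

lemma zero_base_contracted_nbhds:
  assumes "nn_bounded T" "\<nu> > 0"
    and "nn_converges_zero (\<lambda>n x. (1 / \<nu> ^ n) *\<^sub>R (T ^^ n) x)"
  shows "zero_base (contracted_nbhds T \<nu>)"
proof -
  have T: "clinear T" using assms(1) nn_bounded_def by blast
  have half: "\<exists>U\<in>contracted_nbhds T \<nu>. {x + y |x y. x \<in> U \<and> y \<in> U} \<subseteq> V"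
    if V: "V \<in> contracted_nbhds T \<nu>" for V
  proof (rule bexI)
    \<comment> \<open>By convexity, half of \<open>V\<close> added to itself stays in
      \<open>V\<close>.\<close>
    show "scaleC (of_real (1/2)) ` V \<in> contracted_nbhds T \<nu>"
      by (intro contracted_nbhds_scaleC[OF T V]) simp
    have "convex V" using V by (simp add: contracted_nbhds_def)
    then have "x + y \<in> V" if "x \<in> scaleR (1/2) ` V" "y \<in> scaleR (1/2) ` V" for x y
      using convex_scaleR_add[of V x "1/2" y "1/2"] that by simp
    then show "{x + y |x y. x \<in> scaleC (of_real (1/2)) ` V \<and> y \<in> scaleC (of_real (1/2)) ` V} \<subseteq> V"
      unfolding scaleR_scaleC[abs_def] by blast
  qed
  have inter: "V1 \<inter> V2 \<in> contracted_nbhds T \<nu>"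
    if "V1 \<in> contracted_nbhds T \<nu>" "V2 \<in> contracted_nbhds T \<nu>" for V1 V2
  proof -
    have "T ` (V1 \<inter> V2) \<subseteq> scaleR \<nu> ` (V1 \<inter> V2)"
      using that assms(2)
      by (auto simp: contracted_nbhds_def scaleR_image_iff image_subset_iff)
    then show ?thesis
      using that by (auto simp: contracted_nbhds_def balanced_def image_subset_iff convex_Int)
  qed
  show ?thesis
    unfolding zero_base_def
  proof (intro conjI ballI allI impI)
    show "\<exists>V\<in>contracted_nbhds T \<nu>. V \<subseteq> V1 \<inter> V2"
      if "V1 \<in> contracted_nbhds T \<nu>" "V2 \<in> contracted_nbhds T \<nu>" for V1 V2
      using inter[OF that] by blast
  qed (simp_all add: half contracted_nbhd_exists[OF assms] contracted_nbhds_scaleC[OF T],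
      simp_all add: contracted_nbhds_def)
qed

section \<open>Geometric estimates and algebra of the Neumann sums\<close>

lemma contracted_nbhds_funpow:
  assumes T: "clinear T" and "V \<in> contracted_nbhds T \<nu>" and x: "x \<in> scaleR t ` V"
  shows "(T ^^ i) x \<in> scaleR (t * \<nu> ^ i) ` V"
proof (induction i)
  case (Suc i)
  then obtain v where v: "v \<in> V" "(T ^^ i) x = (t * \<nu> ^ i) *\<^sub>R v" by blast
  then obtain w where "w \<in> V" "T v = \<nu> *\<^sub>R w"
    using assms(2) unfolding contracted_nbhds_def by blast
  then show ?case
    using v by (auto simp: clinear_scaleR[OF T] intro!: image_eqI[of _ _ w])
qed (use x in simp)

text \<open>With \<open>q = \<nu> / cmod z\<close>, the term of index \<open>i\<close> lies in the
  dilate of \<open>V\<close> by \<open>t / cmod z * q ^ i\<close>. Convexity adds these factors, and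
  the geometric tail from \<open>m\<close> bounds their sum independently of
  \<open>n\<close>.\<close>

lemma neumann_segment_bound:
  assumes T: "clinear T" and V: "V \<in> contracted_nbhds T \<nu>"
    and \<nu>: "0 < \<nu>" "\<nu> < cmod z" and t: "t > 0" and x: "x \<in> scaleR t ` V" and mn: "m \<le> n"
  shows "(\<Sum>i<n. (1 / z ^ (i + 1)) *\<^sub>C (T ^^ i) x) - (\<Sum>i<m. (1 / z ^ (i + 1)) *\<^sub>C (T ^^ i) x)
         \<in> scaleR (t * ((\<nu> / cmod z) ^ m / (cmod z - \<nu>))) ` V"
proof -
  define q where "q = \<nu> / cmod z"
  have z: "cmod z > 0"
    using \<nu> by linarith
  then have q: "0 < q" "q < 1"
    using \<nu> by (simp_all only: q_def divide_pos_pos pos_divide_less_eq mult_1)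
  have V': "balanced V" "convex V" "0 \<in> V"
    using V interior_subset by (auto simp: contracted_nbhds_def)
  have "(1 / z ^ (i + 1)) *\<^sub>C (T ^^ i) x \<in> scaleR (t / cmod z * q ^ i) ` V" for i
    using \<nu> t z
    by (intro balanced_scaleC[OF V'(1) contracted_nbhds_funpow[OF T V x]])
      (auto simp: q_def norm_divide norm_power norm_mult power_divide field_simps)
  then have segment: "(\<Sum>i=m..<n. (1 / z ^ (i + 1)) *\<^sub>C (T ^^ i) x)
      \<in> scaleR (\<Sum>i=m..<n. t / cmod z * q ^ i) ` V"
    using V' t q z by (intro convex_scaleR_sum) auto
  have le: "(\<Sum>i=m..<n. t / cmod z * q ^ i) \<le> t * (q ^ m / (cmod z - \<nu>))"
  proof -
    have "(\<Sum>i=m..<n. q ^ i) * (1 - q) = q ^ m - q ^ n"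
      using mn by (induction n rule: dec_induct) (simp, simp add: distrib_right, simp add: algebra_simps)
    then have "(\<Sum>i=m..<n. q ^ i) \<le> q ^ m / (1 - q)"
      using q by (simp add: pos_le_divide_eq)
    then have "t / cmod z * (\<Sum>i=m..<n. q ^ i) \<le> t / cmod z * (q ^ m / (1 - q))"
      using t z by (intro mult_left_mono) auto
    also have "\<dots> = t * (q ^ m / (cmod z - \<nu>))"
    proof -
      have "cmod z * (1 - q) = cmod z - \<nu>"
        using z by (simp add: q_def algebra_simps)
      then show ?thesis
        unfolding times_divide_times_eq by simp
    qed
    finally show ?thesis by (simp add: sum_distrib_left)
  qed
  \<comment> \<open>\<open>balanced_scaleR_mono\<close> bounds an absolute value, so the sign of the
    sum matters.\<close>
  have nonneg: "(\<Sum>i=m..<n. t / cmod z * q ^ i) \<ge> 0"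
    using t q z by (intro sum_nonneg) auto
  have "(\<Sum>i=m..<n. (1 / z ^ (i + 1)) *\<^sub>C (T ^^ i) x)
      \<in> scaleR (t * (q ^ m / (cmod z - \<nu>))) ` V"
    by (rule balanced_scaleR_mono[OF V'(1) segment]) (use le nonneg in linarith)
  moreover have "{..<n} - {..<m} = {m..<n}"
    by auto
  ultimately show ?thesis
    using mn sum_diff[of "{..<n}" "{..<m}" "\<lambda>i. (1 / z ^ (i + 1)) *\<^sub>C (T ^^ i) x"]
    by (simp add: q_def)
qed

text \<open>The sum telescopes: \<open>T\<close> applied to one term equals \<open>z\<close> times
  the next.\<close>

lemma shifted_neumann_sum:
  assumes T: "clinear T" and z: "z \<noteq> 0"
  shows "shifted z T (\<Sum>i<n. (1 / z ^ (i + 1)) *\<^sub>C (T ^^ i) x) = x - (1 / z ^ n) *\<^sub>C (T ^^ n) x"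
proof (induction n)
  case (Suc n)
  have "shifted z T ((1 / z ^ (n + 1)) *\<^sub>C (T ^^ n) x)
      = (1 / z ^ n) *\<^sub>C (T ^^ n) x - (1 / z ^ Suc n) *\<^sub>C (T ^^ Suc n) x"
    using T z by (simp add: shifted_def clinear_iff)
  then show ?case
    using Suc clinear_shifted[OF T, of z] by (simp add: clinear_iff)
qed (simp add: clinear_zero[OF clinear_shifted[OF T]])

text \<open>Powers of \<open>T\<close> commute with \<open>shifted z T\<close>. This yields the left
  inverse from the same limit as the right one.\<close>

lemma neumann_sum_shifted:
  assumes T: "clinear T"
  shows "(\<Sum>i<n. (1 / z ^ (i + 1)) *\<^sub>C (T ^^ i) (shifted z T x))
       = shifted z T (\<Sum>i<n. (1 / z ^ (i + 1)) *\<^sub>C (T ^^ i) x)"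
proof -
  have "(1 / z ^ (i + 1)) *\<^sub>C (T ^^ i) (shifted z T x)
      = shifted z T ((1 / z ^ (i + 1)) *\<^sub>C (T ^^ i) x)" for i
    using T clinear_funpow[OF T, of i] clinear_diff[OF clinear_funpow[OF T, of i]]
    by (simp add: shifted_def clinear_iff funpow_swap1 scaleC.scale_right_diff_distrib mult.commute)
  then show ?thesis
    by (simp add: clinear_sum[OF clinear_shifted[OF T]])
qed

text \<open>Sequential completeness gives a pointwise limit \<open>R\<close> of the partial sums.
  Bounds uniform on each contracted neighborhood then show that \<open>R\<close> is nn-bounded and
  that the series nn-converges, both on the same base.\<close>

theorem neumann_series:
  fixes T :: "'a::seq_complete_lcs \<Rightarrow> 'a"
  assumes bdd: "nn_bounded T" and \<nu>: "0 < \<nu>" "\<nu> < cmod z"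
    and conv: "nn_converges_zero (\<lambda>n x. (1 / \<nu> ^ n) *\<^sub>R (T ^^ n) x)"
  shows "bij (shifted z T)"
    and "nn_sums (\<lambda>i x. (1 / z ^ (i + 1)) *\<^sub>C (T ^^ i) x) (inv (shifted z T))"
    and "nn_bounded (inv (shifted z T))"
proof -
  define X where "X n x = (\<Sum>i<n. (1 / z ^ (i + 1)) *\<^sub>C (T ^^ i) x)" for n x
  \<comment> \<open>\<open>B m\<close> is the scalar tail: the sum of
    \<open>\<nu> ^ i / cmod z ^ (i + 1)\<close> over \<open>i \<ge> m\<close>.\<close>
  define B where "B m = (\<nu> / cmod z) ^ m / (cmod z - \<nu>)" for m
  have T: "clinear T" using bdd nn_bounded_def by blast
  have z: "z \<noteq> 0" using \<nu> by auto
  have base: "zero_base (contracted_nbhds T \<nu>)"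
    by (rule zero_base_contracted_nbhds[OF bdd \<nu>(1) conv])
  have B_pos: "B m > 0" for m
    using \<nu> z by (simp add: B_def)
  have B_lim: "B \<longlonglongrightarrow> 0"
  proof -
    have "(\<lambda>m. (\<nu> / cmod z) ^ m / (cmod z - \<nu>)) \<longlonglongrightarrow> 0 / (cmod z - \<nu>)"
      using \<nu> z by (intro tendsto_divide tendsto_const LIMSEQ_power_zero) auto
    then show ?thesis by (simp add: B_def[abs_def])
  qed
  have segment: "X n x - X m x \<in> scaleR (t * B m) ` V"
    if "V \<in> contracted_nbhds T \<nu>" "t > 0" "x \<in> scaleR t ` V" "m \<le> n" for V t x m n
    using neumann_segment_bound[OF T that(1) \<nu> that(2-4)] unfolding X_def B_def .
  have small: "\<forall>\<^sub>F m in sequentially. t * B m \<le> \<epsilon>" if "\<epsilon> > 0" for t \<epsilon>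
  proof -
    have "(\<lambda>m. t * B m) \<longlonglongrightarrow> t * 0"
      by (intro tendsto_mult tendsto_const B_lim)
    then show ?thesis
      using order_tendstoD(2)[of "\<lambda>m. t * B m" 0 sequentially \<epsilon>] that
      by (auto elim: eventually_mono)
  qed
  have "tvs_Cauchy (\<lambda>n. X n x)" for x
    unfolding tvs_Cauchy_def
  proof (intro allI impI, elim conjE)
    fix U :: "'a set" assume "open U" "0 \<in> U"
    then have "0 \<in> interior U" by (simp add: interior_open)
    then obtain V where V: "V \<in> contracted_nbhds T \<nu>" "V \<subseteq> U"
      using zero_base_obtain[OF base] by blast
    then have V': "0 \<in> interior V" "balanced V"
      by (auto simp: contracted_nbhds_def)
    \<comment> \<open>The Cauchy property is pointwise, so the dilation factor \<open>t\<close> may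
      depend on \<open>x\<close>.\<close>
    obtain t where t: "t > 0" "x \<in> scaleR t ` V"
      using absorbing[OF V'(1)] .
    obtain N where N: "\<And>m. m \<ge> N \<Longrightarrow> t * B m \<le> 1"
      using small[of 1 t] by (auto simp: eventually_sequentially)
    have *: "X n x - X m x \<in> scaleR 1 ` V" if "N \<le> m" "m \<le> n" for m n
      using balanced_scaleR_mono[OF V'(2) segment[OF V(1) t that(2)], of 1] N[OF that(1)] t B_pos[of m]
      by simp
    have "X m x - X n x \<in> scaleR 1 ` V" if "N \<le> m" "N \<le> n" for m n
      using *[of m n] *[of n m] balanced_uminus[OF V'(2), of "X n x - X m x" 1] that
      by (cases "m \<le> n") auto
    then show "\<exists>N. \<forall>m\<ge>N. \<forall>n\<ge>N. X m x - X n x \<in> U"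
      using V(2) by auto
  qed
  then have "\<exists>l. (\<lambda>n. X n x) \<longlonglongrightarrow> l" for x
    using tvs_Cauchy_convergent unfolding convergent_def by blast
  then obtain R where R: "\<And>x. (\<lambda>n. X n x) \<longlonglongrightarrow> R x"
    by metis
  \<comment> \<open>Here \<open>t = 1\<close> serves all of \<open>V\<close> at once, and the factor
    2 is the cost of the limit \<open>n \<rightarrow> \<infinity>\<close> in
    \<open>segment\<close>.\<close>
  have tail: "R x - X m x \<in> scaleR (2 * B m) ` V"
    if V: "V \<in> contracted_nbhds T \<nu>" and x: "x \<in> V" for V x m
  proof (rule limit_in_double)
    show "(\<lambda>n. X n x - X m x) \<longlonglongrightarrow> R x - X m x"
      by (intro tendsto_diff tendsto_const R)
    show "\<forall>\<^sub>F n in sequentially. X n x - X m x \<in> scaleR (B m) ` V"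
      using segment[OF V, of 1 x m] x by (auto intro: eventually_sequentiallyI[of m])
  qed (use V B_pos in \<open>auto simp: contracted_nbhds_def\<close>)
  have shift_lim: "(\<lambda>n. shifted z T (X n x)) \<longlonglongrightarrow> shifted z T (R x)" for x
    unfolding shifted_def
    by (intro tendsto_diff tendsto_scaleC tendsto_const R tendsto_nn_bounded[OF bdd])
  have "(\<lambda>n. shifted z T (X n x)) \<longlonglongrightarrow> x" for x
  proof -
    \<comment> \<open>The remainder is \<open>z\<close> times a term of the convergent series.\<close>
    have "(\<lambda>n. x - z *\<^sub>C (X (Suc n) x - X n x)) \<longlonglongrightarrow> x - z *\<^sub>C (R x - R x)"
      by (intro tendsto_diff tendsto_scaleC tendsto_const R LIMSEQ_Suc)
    moreover have "shifted z T (X n x) = x - z *\<^sub>C (X (Suc n) x - X n x)" for n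
      using z shifted_neumann_sum[OF T z, where n = n and x = x] by (simp add: X_def)
    ultimately show ?thesis by simp
  qed
  \<comment> \<open>Limits are unique in a Hausdorff space: \<open>shifted z T (X n x)\<close> tends
    to \<open>x\<close> and to \<open>shifted z T (R x)\<close>, and by commutation it also equals
    \<open>X n (shifted z T x)\<close>, which tends to \<open>R (shifted z T x)\<close>.\<close>
  then have right: "shifted z T (R x) = x" and left: "R (shifted z T x) = x" for x
    using LIMSEQ_unique[OF shift_lim] LIMSEQ_unique[OF R[of "shifted z T x"]]
      neumann_sum_shifted[OF T, where z = z and x = x]
    by (auto simp: X_def)
  show bij: "bij (shifted z T)"
    by (rule o_bij[of R]) (auto simp: fun_eq_iff left right)
  have inv: "inv (shifted z T) = R"
    by (rule inv_equality) (auto simp: left right)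
  show "nn_bounded (inv (shifted z T))"
    unfolding nn_bounded_def
  proof (intro conjI exI ballI)
    show "clinear (inv (shifted z T))"
      by (rule clinear_inv[OF clinear_shifted[OF T] bij])
    show "zero_base (contracted_nbhds T \<nu>)" by (rule base)
    fix V assume "V \<in> contracted_nbhds T \<nu>"
    \<comment> \<open>\<open>X 0\<close> is the empty sum, so \<open>tail\<close> at
      \<open>m = 0\<close> bounds \<open>R\<close> itself.\<close>
    then show "2 * B 0 > 0" "inv (shifted z T) ` V \<subseteq> scaleR (2 * B 0) ` V"
      using tail[of V _ 0] B_pos[of 0] by (auto simp: inv X_def)
  qed
  show "nn_sums (\<lambda>i x. (1 / z ^ (i + 1)) *\<^sub>C (T ^^ i) x) (inv (shifted z T))"
    unfolding nn_sums_def nn_converges_def nn_converges_zero_def inv X_def[symmetric]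
  proof (intro conjI exI ballI allI impI)
    show "zero_base (contracted_nbhds T \<nu>)" by (rule base)
    fix V and \<epsilon> :: real assume V: "V \<in> contracted_nbhds T \<nu>" and "\<epsilon> > 0"
    have bal: "balanced V" using V by (simp add: contracted_nbhds_def)
    from small[OF \<open>\<epsilon> > 0\<close>, of 2]
    show "\<forall>\<^sub>F n in sequentially. (\<lambda>x. X n x - R x) ` V \<subseteq> scaleR \<epsilon> ` V"
    proof eventually_elim
      case (elim n)
      have "X n x - R x \<in> scaleR \<epsilon> ` V" if "x \<in> V" for x
        using balanced_uminus[OF bal balanced_scaleR_mono[OF bal tail[OF V that, of n], of \<epsilon>]]
          elim B_pos[of n] \<open>\<epsilon> > 0\<close> by simp
      then show ?case by blast
    qed
  qed
qed

section \<open>From a fixed \<open>\<nu>\<close> to the spectral radius\<close>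

theorem theorem5p4:
  fixes T :: "'a::seq_complete_lcs \<Rightarrow> 'a"
  assumes "nn_bounded T"
  shows "(\<forall>z. nn_spectral_radius T < ennreal (cmod z) \<longrightarrow>
            bij (shifted z T) \<and>
            nn_sums (\<lambda>i x. (1 / z ^ (i + 1)) *\<^sub>C (T ^^ i) x) (inv (shifted z T)) \<and>
            nn_bounded (inv (shifted z T))) \<and>
         set_modulus (nn_spectrum T) \<le> nn_spectral_radius T"
proof -
  have *: "bij (shifted z T) \<and>
            nn_sums (\<lambda>i x. (1 / z ^ (i + 1)) *\<^sub>C (T ^^ i) x) (inv (shifted z T)) \<and>
            nn_bounded (inv (shifted z T))"
    if "nn_spectral_radius T < ennreal (cmod z)" for z
  proof -
    \<comment> \<open>An infimum strictly below \<open>cmod z\<close> has an admissible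
      \<open>\<nu>\<close> strictly below \<open>cmod z\<close>.\<close>
    obtain \<nu> where "\<nu> > 0" "nn_converges_zero (\<lambda>n x. (1 / \<nu> ^ n) *\<^sub>R (T ^^ n) x)"
      and "ennreal \<nu> < ennreal (cmod z)"
      using \<open>nn_spectral_radius T < ennreal (cmod z)\<close>
      unfolding nn_spectral_radius_def INF_less_iff by blast
    then show ?thesis
      using neumann_series[OF assms, of \<nu> z] by (simp add: ennreal_less_iff)
  qed
  moreover have "set_modulus (nn_spectrum T) \<le> nn_spectral_radius T"
    unfolding set_modulus_def
  proof (rule SUP_least)
    fix z assume "z \<in> nn_spectrum T"
    then show "ennreal (cmod z) \<le> nn_spectral_radius T"
      \<comment> \<open>Contrapositive: beyond the spectral radius, \<open>z\<close> would lie in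
        the resolvent set.\<close>
      using *[of z] by (auto simp: nn_spectrum_def nn_resolvent_set_def not_less[symmetric])
  qed
  ultimately show ?thesis by blast
qed

end
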